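(* Let $G$ be a group (finite or infinite). Every right-invariant metric on $G$ is also bi-invariant if and only if either $G$ is abelian or $G\cong \mathbb{Q}_8\times H$, where $\mathbb{Q}_8$ is the quaternion group of order $8$ and $H$ is an elementary abelian $2$-group. In particular, if $G$ is finite and non-abelian with this property, then $G\cong\mathbb{Q}_8\times\mathbb{Z}_2^k$ for some $k\in\mathbb{Z}_{\ge 0}$, and $M(G)=M^*(G)=B_{5\cdot 2^k-1}$.
   Context: A metric $d$ on a group $G$ is right-invariant if $d(gh,g'h)=d(g,g')$ for all $g,g',h\in G$, left-invariant if $d(hg,hg')=d(g,g')$ for all $g,g',h$, and bi-invariant if both. For a right-invariant metric $d$, its weight is $w(x)=d(x,e)$ and its induced partition $P(G,d)$ is the partition of $G$ into the classes of the relation $g\sim h\iff w(g)=w(h)$. Two right-invariant metrics are $\mathcal{P}$-equivalent if they have the same induced partition. For a finite group $G$, $M(G)$ denotes the number of $\mathcal{P}$-equivalence classes of right-invariant metrics on $G$, and $M^*(G)$ denotes the number of $\mathcal{P}$-equivalence classes of bi-invariant metrics on $G$. $B_m$ denotes the $m$-th Bell number (number of partitions of an $m$-element set). An elementary abelian $2$-group is an abelian group in which every nontrivial element has order $2$. *)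

theory Defs
  imports
    "HOL-Analysis.Abstract_Metric_Spaces"
    "HOL-Algebra.Algebra"
    "HOL-Library.Disjoint_Sets"
begin

text \<open>
  The locale \<^locale>\<open>Metric_space\<close> asks for \<open>0 \<le> d x y\<close> and \<open>d x y = d y x\<close> for all \<open>x\<close>, \<open>y\<close> of the
  underlying type, but every metric on the carrier extends (by zero) to such a function, and nothing
  below depends on the values of \<open>d\<close> outside the carrier.
\<close>

definition right_invariant_metric ::
    "('a, 'm) monoid_scheme \<Rightarrow> ('a \<Rightarrow> 'a \<Rightarrow> real) \<Rightarrow> bool" where
  "right_invariant_metric G d \<longleftrightarrow>
     Metric_space (carrier G) d \<and>
     (\<forall>g \<in> carrier G. \<forall>g' \<in> carrier G. \<forall>h \<in> carrier G.
        d (g \<otimes>\<^bsub>G\<^esub> h) (g' \<otimes>\<^bsub>G\<^esub> h) = d g g')"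

definition left_invariant_metric ::
    "('a, 'm) monoid_scheme \<Rightarrow> ('a \<Rightarrow> 'a \<Rightarrow> real) \<Rightarrow> bool" where
  "left_invariant_metric G d \<longleftrightarrow>
     Metric_space (carrier G) d \<and>
     (\<forall>g \<in> carrier G. \<forall>g' \<in> carrier G. \<forall>h \<in> carrier G.
        d (h \<otimes>\<^bsub>G\<^esub> g) (h \<otimes>\<^bsub>G\<^esub> g') = d g g')"

definition bi_invariant_metric ::
    "('a, 'm) monoid_scheme \<Rightarrow> ('a \<Rightarrow> 'a \<Rightarrow> real) \<Rightarrow> bool" where
  "bi_invariant_metric G d \<longleftrightarrow> right_invariant_metric G d \<and> left_invariant_metric G d"

definition weight :: "('a, 'm) monoid_scheme \<Rightarrow> ('a \<Rightarrow> 'a \<Rightarrow> real) \<Rightarrow> 'a \<Rightarrow> real" where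
  "weight G d x = d x \<one>\<^bsub>G\<^esub>"

definition induced_partition ::
    "('a, 'm) monoid_scheme \<Rightarrow> ('a \<Rightarrow> 'a \<Rightarrow> real) \<Rightarrow> 'a set set" where
  "induced_partition G d =
     carrier G // {(g, h). g \<in> carrier G \<and> h \<in> carrier G \<and> weight G d g = weight G d h}"

definition P_equivalent ::
    "('a, 'm) monoid_scheme \<Rightarrow> ('a \<Rightarrow> 'a \<Rightarrow> real) \<Rightarrow> ('a \<Rightarrow> 'a \<Rightarrow> real) \<Rightarrow> bool" where
  "P_equivalent G d d' \<longleftrightarrow> induced_partition G d = induced_partition G d'"

definition num_right_invariant :: "('a, 'm) monoid_scheme \<Rightarrow> nat" where
  "num_right_invariant G =
     card ({d. right_invariant_metric G d} //
       {(d, d'). right_invariant_metric G d \<and> right_invariant_metric G d' \<and> P_equivalent G d d'})"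

definition num_bi_invariant :: "('a, 'm) monoid_scheme \<Rightarrow> nat" where
  "num_bi_invariant G =
     card ({d. bi_invariant_metric G d} //
       {(d, d'). bi_invariant_metric G d \<and> bi_invariant_metric G d' \<and> P_equivalent G d d'})"

definition Bell :: "nat \<Rightarrow> nat" where
  "Bell m = card {P. partition_on {..<m} P}"

text \<open>
  The quadruple \<open>(a, b, c, d)\<close> stands for the Hamilton quaternion \<open>a + bi + cj + dk\<close>; the carrier
  is \<open>{\<plusminus>1, \<plusminus>i, \<plusminus>j, \<plusminus>k}\<close>.
\<close>

fun hamilton_mult ::
    "int \<times> int \<times> int \<times> int \<Rightarrow> int \<times> int \<times> int \<times> int \<Rightarrow> int \<times> int \<times> int \<times> int" where
  "hamilton_mult (a, b, c, d) (a', b', c', d') =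
     (a * a' - b * b' - c * c' - d * d',
      a * b' + b * a' + c * d' - d * c',
      a * c' - b * d' + c * a' + d * b',
      a * d' + b * c' - c * b' + d * a')"

definition Q8 :: "(int \<times> int \<times> int \<times> int) monoid" where
  "Q8 = \<lparr>carrier = {(1, 0, 0, 0), (-1, 0, 0, 0), (0, 1, 0, 0), (0, -1, 0, 0),
                    (0, 0, 1, 0), (0, 0, -1, 0), (0, 0, 0, 1), (0, 0, 0, -1)},
         monoid.mult = hamilton_mult,
         one = (1, 0, 0, 0)\<rparr>"

lemma group_Q8: "group Q8"
proof (rule groupI)
  fix x y z
  show "x \<otimes>\<^bsub>Q8\<^esub> y \<otimes>\<^bsub>Q8\<^esub> z = x \<otimes>\<^bsub>Q8\<^esub> (y \<otimes>\<^bsub>Q8\<^esub> z)"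
    by (cases x; cases y; cases z) (simp add: Q8_def algebra_simps)
qed (auto simp: Q8_def)

lemma order_Q8: "order Q8 = 8"
  by (simp add: order_def Q8_def)

definition elementary_abelian_2_group :: "('a, 'm) monoid_scheme \<Rightarrow> bool" where
  "elementary_abelian_2_group H \<longleftrightarrow>
     comm_group H \<and> (\<forall>x \<in> carrier H. x \<noteq> \<one>\<^bsub>H\<^esub> \<longrightarrow> group.ord H x = 2)"

text \<open>
  A factor \<open>H\<close> with \<open>G \<cong> Q8 \<times>\<times> H\<close> embeds into \<open>G\<close>, so quantifying over groups \<open>H\<close> on the element
  type of \<open>G\<close> covers groups \<open>H\<close> on any type.
\<close>

lemma elementary_abelian_2_factor_same_type:
  fixes G :: "('a, 'm) monoid_scheme" and H :: "('b, 'n) monoid_scheme"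
  assumes G: "group G" and H: "elementary_abelian_2_group H" and iso: "G \<cong> Q8 \<times>\<times> H"
  shows "\<exists>K :: 'a monoid. elementary_abelian_2_group K \<and> G \<cong> Q8 \<times>\<times> K"
proof -
  interpret H: comm_group H
    using H by (simp add: elementary_abelian_2_group_def)
  interpret Q: group Q8 by (rule group_Q8)
  obtain f where f: "f \<in> Group.iso (Q8 \<times>\<times> H) G"
    using group.iso_sym[OF G iso] unfolding is_iso_def by blast
  define e where "e y = f (\<one>\<^bsub>Q8\<^esub>, y)" for y
  have e_hom: "e \<in> hom H G"
    using f by (auto simp: e_def iso_def hom_def DirProd_def Pi_iff split: prod.splits)
       (metis Q.l_one Q.one_closed)
  have e_inj: "inj_on e (carrier H)"
    using f by (auto simp: e_def iso_def bij_betw_def inj_on_def DirProd_def)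
  define K where "K = \<lparr>carrier = e ` carrier H, monoid.mult = monoid.mult G, one = \<one>\<^bsub>G\<^esub>\<rparr>"
  have eK: "e \<in> Group.iso H K"
    using e_hom e_inj by (auto simp: iso_def hom_def bij_betw_def K_def)
  interpret e: group_hom H G e
    using e_hom G H.is_group by (simp add: group_hom_def group_hom_axioms_def)
  have "monoid K"
    by (rule monoidI) (use G in \<open>auto simp: K_def group.is_monoid monoid.m_assoc monoid.l_one monoid.r_one
      simp flip: e.hom_mult e.hom_one\<close>)
  then interpret K: comm_group K
    using H.iso_imp_comm_group is_isoI[OF eK] by blast
  interpret eK: group_hom H K e
    using eK H.is_group K.is_group by (simp add: group_hom_def group_hom_axioms_def iso_def)
  have "K.ord y = 2" if y: "y \<in> carrier K" "y \<noteq> \<one>\<^bsub>K\<^esub>" for y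
  proof -
    obtain x where x: "x \<in> carrier H" "y = e x" using y(1) by (auto simp: K_def)
    have "x \<noteq> \<one>\<^bsub>H\<^esub>" using y(2) x(2) eK.hom_one by blast
    then have 2: "H.ord x = 2"
      using H x(1) by (simp add: elementary_abelian_2_group_def)
    have "y [^]\<^bsub>K\<^esub> n = \<one>\<^bsub>K\<^esub> \<longleftrightarrow> x [^]\<^bsub>H\<^esub> n = \<one>\<^bsub>H\<^esub>" for n :: nat
      using x e_inj by (metis H.nat_pow_closed H.one_closed eK.hom_nat_pow eK.hom_one inj_onD)
    then show ?thesis
      using 2 x(1) y(1) by (simp add: K.ord_unique H.pow_eq_id)
  qed
  then have "elementary_abelian_2_group K"
    by (simp add: elementary_abelian_2_group_def K.comm_group_axioms)
  moreover have "G \<cong> Q8 \<times>\<times> K"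
    using iso iso_trans Q.DirProd_iso_trans[OF iso_refl is_isoI[OF eK]] by blast
  ultimately show ?thesis by blast
qed

end

theory Submission
  imports Defs
begin

text \<open>
  A right-invariant metric is determined by its weight, and every symmetric function vanishing at the
  identity with its other values in \<open>[1, 2]\<close> is a weight. Taking the value 1 on \<open>{x, x\<^sup>-\<^sup>1}\<close> only, one
  sees that all right-invariant metrics are bi-invariant iff every conjugate of \<open>x\<close> is \<open>x\<close> or \<open>x\<^sup>-\<^sup>1\<close>.
  In a group with this property, non-commuting \<open>a\<close>, \<open>b\<close> satisfy \<open>aba = b\<close> and \<open>bab = a\<close>, hence generate a
  copy of the quaternion group with centre \<open>{1, z}\<close>, \<open>z = a\<^sup>2\<close>. Multiplying any element by one of
  \<open>1, a, b, ab\<close> makes it centralize \<open>a\<close> and \<open>b\<close>; and for \<open>c\<close> in that centralizer, \<open>ac\<close> does not commute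
  with \<open>b\<close>, so it is inverted by \<open>b\<close>, which forces \<open>c\<^sup>2 = 1\<close>. A complement of \<open>{1, z}\<close> in the centralizer
  is the second factor.

  For finite groups, the same weights realize every partition of \<open>G - {1}\<close> into sets closed
  under inversion, so one counts the partitions of the set of classes \<open>{x, x\<^sup>-\<^sup>1}\<close>.
\<close>

section \<open>Right-invariant metrics from weights\<close>

context group
begin

definition conj_self_or_inv :: bool where
  "conj_self_or_inv \<longleftrightarrow>
     (\<forall>g \<in> carrier G. \<forall>x \<in> carrier G. g \<otimes> x \<otimes> inv g = x \<or> g \<otimes> x \<otimes> inv g = inv x)"

text \<open>With all nontrivial values in \<open>[1, 2]\<close>, the triangle inequality is automatic.\<close>

lemma right_invariant_metric_of_weight:
  fixes w :: "'a \<Rightarrow> real"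
  assumes one: "w \<one> = 0"
    and bounds: "\<And>x. x \<in> carrier G \<Longrightarrow> x \<noteq> \<one> \<Longrightarrow> 1 \<le> w x \<and> w x \<le> 2"
    and sym: "\<And>x. x \<in> carrier G \<Longrightarrow> w (inv x) = w x"
  obtains d where "right_invariant_metric G d" "\<And>x. x \<in> carrier G \<Longrightarrow> weight G d x = w x"
proof
  \<comment> \<open>\<open>Metric_space\<close> asks for nonnegativity and symmetry on the whole
    type, hence the value 0 off the carrier.\<close>
  define d where "d x y = (if x \<in> carrier G \<and> y \<in> carrier G then w (x \<otimes> inv y) else 0)" for x y
  have nonneg: "0 \<le> w x" if "x \<in> carrier G" for x
    using bounds[of x] one that by (cases "x = \<one>") auto
  have eq_one: "x \<otimes> inv y = \<one> \<longleftrightarrow> x = y" if "x \<in> carrier G" "y \<in> carrier G" for x y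
    using that by (metis inv_closed inv_equality inv_inv r_inv)
  have eq_zero: "w x = 0 \<longleftrightarrow> x = \<one>" if "x \<in> carrier G" for x
    using bounds[of x] one that by force
  have "Metric_space (carrier G) d"
  proof
    show "0 \<le> d x y" for x y
      using nonneg by (simp add: d_def)
    show "d x y = d y x" for x y
      using sym[of "x \<otimes> inv y"] by (auto simp: d_def inv_mult_group)
    show "d x y = 0 \<longleftrightarrow> x = y" if "x \<in> carrier G" "y \<in> carrier G" for x y
      using that by (simp add: d_def eq_zero eq_one)
    show "d x z \<le> d x y + d y z" if xyz: "x \<in> carrier G" "y \<in> carrier G" "z \<in> carrier G" for x y z
    \<comment> \<open>The lower bound 1 needs distinct points. For three of them the left side is at
      most 2 and each summand on the right at least 1.\<close>
    proof (cases "x = y \<or> y = z \<or> x = z")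
      case True
      then show ?thesis
        using xyz one nonneg by (auto simp: d_def)
    next
      case False
      then show ?thesis
        using xyz bounds[of "x \<otimes> inv z"] bounds[of "x \<otimes> inv y"] bounds[of "y \<otimes> inv z"]
        by (simp add: d_def eq_one)
    qed
  qed
  then show "right_invariant_metric G d"
    unfolding right_invariant_metric_def
    by (simp add: d_def inv_mult_group) (metis inv_closed inv_solve_right m_assoc m_closed)
  show "weight G d x = w x" if "x \<in> carrier G" for x
    using that by (simp add: weight_def d_def)
qed

lemma right_invariant_metric_eq_weight:
  assumes d: "right_invariant_metric G d" and "x \<in> carrier G" "y \<in> carrier G"
  shows "d x y = weight G d (x \<otimes> inv y)"
proof -
  have "d (x \<otimes> inv y) (y \<otimes> inv y) = d x y"
    using assms unfolding right_invariant_metric_def by blast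
  then show ?thesis
    using assms by (simp add: weight_def)
qed

lemma weight_one:
  assumes "right_invariant_metric G d"
  shows "weight G d \<one> = 0"
  using assms Metric_space.zero[of "carrier G" d \<one> \<one>]
  by (simp add: right_invariant_metric_def weight_def)

lemma weight_pos:
  assumes "right_invariant_metric G d" "x \<in> carrier G" "x \<noteq> \<one>"
  shows "weight G d x > 0"
  using assms Metric_space.zero[of "carrier G" d x \<one>] Metric_space.nonneg[of "carrier G" d x \<one>]
  by (simp add: right_invariant_metric_def weight_def less_le)

text \<open>Symmetry of the metric in disguise: right translation by \<open>inv x\<close> turns the
  distance from \<open>\<one>\<close> to \<open>x\<close> into the weight of
  \<open>inv x\<close>.\<close>

lemma weight_inv:
  assumes "right_invariant_metric G d" "x \<in> carrier G"
  shows "weight G d (inv x) = weight G d x"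
proof -
  have "d \<one> x = d x \<one>"
    using assms Metric_space.commute[of "carrier G" d \<one> x]
    by (simp add: right_invariant_metric_def)
  then show ?thesis
    using right_invariant_metric_eq_weight[of d \<one> x] assms by (simp add: weight_def)
qed

lemma all_right_invariant_bi_invariant_iff:
  "(\<forall>d. right_invariant_metric G d \<longrightarrow> bi_invariant_metric G d) \<longleftrightarrow> conj_self_or_inv"
proof
  assume all: "\<forall>d. right_invariant_metric G d \<longrightarrow> bi_invariant_metric G d"
  show conj_self_or_inv
    unfolding conj_self_or_inv_def
  proof (intro ballI)
    fix g x assume g: "g \<in> carrier G" and x: "x \<in> carrier G"
    define w :: "'a \<Rightarrow> real" where
      "w y = (if y = \<one> then 0 else if y = x \<or> y = inv x then 1 else 2)" for y
    have inv_eq: "inv y = x \<longleftrightarrow> y = inv x" "inv y = inv x \<longleftrightarrow> y = x" "inv y = \<one> \<longleftrightarrow> y = \<one>"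
      if "y \<in> carrier G" for y
      using that x by (metis inv_inv inv_one)+
    obtain d where d: "right_invariant_metric G d"
      and w: "\<And>y. y \<in> carrier G \<Longrightarrow> weight G d y = w y"
      by (rule right_invariant_metric_of_weight[of w]) (auto simp: w_def inv_eq)
    have "left_invariant_metric G d"
      using all d by (simp add: bi_invariant_metric_def)
    \<comment> \<open>Read through the weight, left invariance compares a conjugate of
      \<open>x\<close> with \<open>x\<close>; the value 1 is taken at most at \<open>x\<close> and
      \<open>inv x\<close>, the value 0 only at \<open>\<one>\<close>.\<close>
    then have "d (g \<otimes> x) (g \<otimes> \<one>) = d x \<one>"
      using g x unfolding left_invariant_metric_def by blast
    then have "w (g \<otimes> x \<otimes> inv g) = w x"
      using g x by (simp add: right_invariant_metric_eq_weight[OF d] w)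
    then show "g \<otimes> x \<otimes> inv g = x \<or> g \<otimes> x \<otimes> inv g = inv x"
      using g x by (cases "x = \<one>") (auto simp: w_def split: if_splits)
  qed
next
  assume C: conj_self_or_inv
  show "\<forall>d. right_invariant_metric G d \<longrightarrow> bi_invariant_metric G d"
  proof (intro allI impI)
    fix d assume d: "right_invariant_metric G d"
    have "d (h \<otimes> g) (h \<otimes> g') = d g g'"
      if gh: "g \<in> carrier G" "g' \<in> carrier G" "h \<in> carrier G" for g g' h
    proof -
      \<comment> \<open>The quotient of \<open>h \<otimes> g\<close> by
        \<open>h \<otimes> g'\<close> is this conjugate of \<open>g \<otimes> inv g'\<close>, and
        weights do not distinguish an element from its inverse.\<close>
      have "h \<otimes> (g \<otimes> inv g') \<otimes> inv h = g \<otimes> inv g' \<or> h \<otimes> (g \<otimes> inv g') \<otimes> inv h = inv (g \<otimes> inv g')"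
        using C gh unfolding conj_self_or_inv_def by blast
      then have "weight G d (h \<otimes> (g \<otimes> inv g') \<otimes> inv h) = weight G d (g \<otimes> inv g')"
        using gh by (metis weight_inv[OF d] inv_closed m_closed)
      then show ?thesis
        using gh by (simp add: right_invariant_metric_eq_weight[OF d] inv_mult_group m_assoc)
    qed
    then show "bi_invariant_metric G d"
      using d by (simp add: bi_invariant_metric_def left_invariant_metric_def right_invariant_metric_def)
  qed
qed

end

lemma conj_self_or_inv_iso:
  assumes G: "group G" and H: "group H" and iso: "G \<cong> H" and C: "group.conj_self_or_inv H"
  shows "group.conj_self_or_inv G"
proof -
  interpret G: group G by fact
  interpret H: group H by fact
  obtain f where f: "f \<in> Group.iso G H"
    using iso by (auto simp: is_iso_def)
  interpret f: group_hom G H f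
    using f by unfold_locales (simp add: iso_def)
  have inj: "inj_on f (carrier G)"
    using f by (simp add: iso_def bij_betw_def)
  show ?thesis
    unfolding G.conj_self_or_inv_def
  proof (intro ballI)
    fix g x assume gx: "g \<in> carrier G" "x \<in> carrier G"
    have "f (g \<otimes>\<^bsub>G\<^esub> x \<otimes>\<^bsub>G\<^esub> inv\<^bsub>G\<^esub> g) = f x \<or> f (g \<otimes>\<^bsub>G\<^esub> x \<otimes>\<^bsub>G\<^esub> inv\<^bsub>G\<^esub> g) = f (inv\<^bsub>G\<^esub> x)"
      using C gx unfolding H.conj_self_or_inv_def by simp
    then show "g \<otimes>\<^bsub>G\<^esub> x \<otimes>\<^bsub>G\<^esub> inv\<^bsub>G\<^esub> g = x \<or> g \<otimes>\<^bsub>G\<^esub> x \<otimes>\<^bsub>G\<^esub> inv\<^bsub>G\<^esub> g = inv\<^bsub>G\<^esub> x"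
      using gx inj by (meson G.inv_closed G.m_closed inj_onD)
  qed
qed

section \<open>Elementary abelian 2-groups\<close>

text \<open>Trades element orders for an equation. Commutativity comes for free: when all elements
  are their own inverses, inverting a product swaps its factors and changes nothing.\<close>

lemma elementary_abelian_2_group_iff:
  "elementary_abelian_2_group H \<longleftrightarrow> group H \<and> (\<forall>x \<in> carrier H. x \<otimes>\<^bsub>H\<^esub> x = \<one>\<^bsub>H\<^esub>)"
proof (cases "group H")
  case True
  interpret group H by fact
  have sq: "x [^]\<^bsub>H\<^esub> (2 :: nat) = x \<otimes>\<^bsub>H\<^esub> x" if "x \<in> carrier H" for x
    using that by (simp add: numeral_2_eq_2)
  have ord: "(x \<noteq> \<one>\<^bsub>H\<^esub> \<longrightarrow> ord x = 2) \<longleftrightarrow> x \<otimes>\<^bsub>H\<^esub> x = \<one>\<^bsub>H\<^esub>" if x: "x \<in> carrier H" for x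
  proof (cases "x = \<one>\<^bsub>H\<^esub>")
    case False
    then have "ord x \<noteq> 1"
      using x ord_eq_1 by simp
    then have "ord x = 2 \<longleftrightarrow> ord x dvd 2"
      using prime_nat_iff two_is_prime_nat by (metis dvd_refl)
    then show ?thesis
      using False x pow_eq_id[of x 2] sq by simp
  qed simp
  moreover have "comm_group H" if inv2: "\<forall>x \<in> carrier H. x \<otimes>\<^bsub>H\<^esub> x = \<one>\<^bsub>H\<^esub>"
  proof (rule group_comm_groupI)
    fix x y assume xy: "x \<in> carrier H" "y \<in> carrier H"
    have "inv\<^bsub>H\<^esub> x = x" if "x \<in> carrier H" for x
      using that inv2 inv_equality by blast
    then show "x \<otimes>\<^bsub>H\<^esub> y = y \<otimes>\<^bsub>H\<^esub> x"
      using xy inv_mult_group[OF xy] by simp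
  qed
  ultimately show ?thesis
    using True unfolding elementary_abelian_2_group_def by blast
qed (simp add: elementary_abelian_2_group_def comm_group_def)

lemma elementary_abelian_2_subgroup:
  assumes "subgroup K H" "elementary_abelian_2_group H"
  shows "elementary_abelian_2_group (H\<lparr>carrier := K\<rparr>)"
  using assms group.subgroup_imp_group[of H K] subgroup.subset[of K H]
  by (auto simp: elementary_abelian_2_group_iff)

text \<open>A subgroup that is maximal among those avoiding \<open>z\<close> has index 2.\<close>

lemma elementary_abelian_2_complement:
  assumes H: "elementary_abelian_2_group H" and z: "z \<in> carrier H" "z \<noteq> \<one>\<^bsub>H\<^esub>"
  obtains K where "subgroup K H" "z \<notin> K" "\<And>x. x \<in> carrier H \<Longrightarrow> x \<in> K \<or> z \<otimes>\<^bsub>H\<^esub> x \<in> K"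
proof -
  interpret comm_group H
    using H by (simp add: elementary_abelian_2_group_def)
  have sq: "x \<otimes>\<^bsub>H\<^esub> x = \<one>\<^bsub>H\<^esub>" if "x \<in> carrier H" for x
    using that H by (simp add: elementary_abelian_2_group_iff)
  have inv_self: "inv\<^bsub>H\<^esub> x = x" if "x \<in> carrier H" for x
    using that sq inv_equality by blast
  define \<S> where "\<S> = {K. subgroup K H \<and> z \<notin> K}"
  \<comment> \<open>\<open>H\<close> may be infinite, so a maximal subgroup comes from Zorn's lemma,
    with unions of chains as upper bounds.\<close>
  have "\<exists>M\<in>\<S>. \<forall>L\<in>\<S>. M \<subseteq> L \<longrightarrow> L = M"
  proof (rule subset_Zorn_nonempty)
    show "\<S> \<noteq> {}"
      using triv_subgroup z by (auto simp: \<S>_def)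
    fix C assume C: "C \<noteq> {}" "subset.chain \<S> C"
    have sub: "subgroup K H" "z \<notin> K" if "K \<in> C" for K
      using that C(2) by (auto simp: \<S>_def subset.chain_def)
    have "subgroup (\<Union>C) H"
    proof (rule subgroupI)
      show "\<Union>C \<subseteq> carrier H"
        using sub subgroup.subset by blast
      show "\<Union>C \<noteq> {}"
        using C(1) sub subgroup.one_closed by blast
      show "inv\<^bsub>H\<^esub> x \<in> \<Union>C" if "x \<in> \<Union>C" for x
        using that sub subgroup.m_inv_closed by fast
      show "x \<otimes>\<^bsub>H\<^esub> y \<in> \<Union>C" if xy: "x \<in> \<Union>C" "y \<in> \<Union>C" for x y
      proof -
        obtain L Y where XY: "L \<in> C" "x \<in> L" "Y \<in> C" "y \<in> Y"
          using xy by blast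
        then have "L \<subseteq> Y \<or> Y \<subseteq> L"
          using C(2) by (auto simp: subset_chain_def)
        then show ?thesis
          using XY sub subgroup.m_closed by (metis UnionI subsetD)
      qed
    qed
    then show "\<Union>C \<in> \<S>"
      using sub by (auto simp: \<S>_def)
  qed
  then obtain K where K: "subgroup K H" "z \<notin> K"
    and max: "\<And>L. subgroup L H \<Longrightarrow> z \<notin> L \<Longrightarrow> K \<subseteq> L \<Longrightarrow> L = K"
    by (auto simp: \<S>_def)
  interpret K: subgroup K H by fact
  have "z \<otimes>\<^bsub>H\<^esub> x \<in> K" if x: "x \<in> carrier H" "x \<notin> K" for x
  proof -
    \<comment> \<open>The subgroup generated by \<open>K\<close> and \<open>x\<close>: as
      \<open>x\<close> is its own inverse, the second alternative describes the coset of
      \<open>K\<close> through \<open>x\<close>.\<close>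
    define L where "L = {y \<in> carrier H. y \<in> K \<or> x \<otimes>\<^bsub>H\<^esub> y \<in> K}"
    have "subgroup L H"
    proof (rule subgroupI)
      show "L \<subseteq> carrier H" "L \<noteq> {}"
        by (auto simp: L_def)
      show "inv\<^bsub>H\<^esub> y \<in> L" if "y \<in> L" for y
        using that by (auto simp: L_def inv_self)
      show "u \<otimes>\<^bsub>H\<^esub> v \<in> L" if "u \<in> L" "v \<in> L" for u v
      proof -
        have uv: "u \<in> carrier H" "v \<in> carrier H"
          using that by (auto simp: L_def)
        have "(x \<otimes>\<^bsub>H\<^esub> u) \<otimes>\<^bsub>H\<^esub> v = x \<otimes>\<^bsub>H\<^esub> (u \<otimes>\<^bsub>H\<^esub> v)" "u \<otimes>\<^bsub>H\<^esub> (x \<otimes>\<^bsub>H\<^esub> v) = x \<otimes>\<^bsub>H\<^esub> (u \<otimes>\<^bsub>H\<^esub> v)"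
          using uv x(1) by (simp_all add: m_ac)
        moreover have "(x \<otimes>\<^bsub>H\<^esub> u) \<otimes>\<^bsub>H\<^esub> (x \<otimes>\<^bsub>H\<^esub> v) = (x \<otimes>\<^bsub>H\<^esub> x) \<otimes>\<^bsub>H\<^esub> (u \<otimes>\<^bsub>H\<^esub> v)"
          using uv x(1) by (simp add: m_ac)
        then have "(x \<otimes>\<^bsub>H\<^esub> u) \<otimes>\<^bsub>H\<^esub> (x \<otimes>\<^bsub>H\<^esub> v) = u \<otimes>\<^bsub>H\<^esub> v"
          using uv x(1) by (simp add: sq)
        ultimately show ?thesis
          using that K.m_closed[of u v] K.m_closed[of "x \<otimes>\<^bsub>H\<^esub> u" v] K.m_closed[of u "x \<otimes>\<^bsub>H\<^esub> v"]
            K.m_closed[of "x \<otimes>\<^bsub>H\<^esub> u" "x \<otimes>\<^bsub>H\<^esub> v"] by (auto simp: L_def)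
      qed
    qed
    moreover have "K \<subseteq> L" "x \<in> L"
      using x sq by (auto simp: L_def)
    \<comment> \<open>\<open>L\<close> properly contains \<open>K\<close>, so it contains
      \<open>z\<close> by maximality; since \<open>z\<close> is not in \<open>K\<close>, it lies in
      the coset through \<open>x\<close>.\<close>
    ultimately have "z \<in> L"
      using max[of L] x(2) by auto
    then show ?thesis
      using K(2) x(1) z(1) by (simp add: L_def m_comm)
  qed
  then show thesis
    using K that by blast
qed

text \<open>The inductive step of the classification below: the new coordinate is sent to powers of
  \<open>z\<close>, the old ones are still mapped by \<open>f\<close>.\<close>

lemma elementary_abelian_2_index_2_hom:
  assumes H: "elementary_abelian_2_group H" and z: "z \<in> carrier H" and K: "subgroup K H"
    and f: "f \<in> hom (product_group {..<k} (\<lambda>_. integer_mod_group 2)) (H\<lparr>carrier := K\<rparr>)"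
  defines "g \<equiv> \<lambda>x. (if x k = (0 :: int) then \<one>\<^bsub>H\<^esub> else z) \<otimes>\<^bsub>H\<^esub> f (restrict x {..<k})"
  shows "g \<in> hom (product_group {..<Suc k} (\<lambda>_. integer_mod_group 2)) H"
proof (rule homI)
  interpret comm_group H
    using H by (simp add: elementary_abelian_2_group_def)
  have sq: "x \<otimes>\<^bsub>H\<^esub> x = \<one>\<^bsub>H\<^esub>" if "x \<in> carrier H" for x
    using that H by (simp add: elementary_abelian_2_group_iff)
  let ?P = "\<lambda>k. product_group {..<k :: nat} (\<lambda>_. integer_mod_group 2)"
  have res: "restrict x {..<k} \<in> carrier (?P k)" if "x \<in> carrier (?P (Suc k))" for x
    using that by (simp add: PiE_iff)
  have fH: "f x \<in> carrier H" if "x \<in> carrier (?P k)" for x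
    using hom_in_carrier[OF f that] K subgroup.subset by auto
  show "g x \<in> carrier H" if "x \<in> carrier (?P (Suc k))" for x
    using fH[OF res[OF that]] z by (simp add: g_def)
  fix x y assume x: "x \<in> carrier (?P (Suc k))" and y: "y \<in> carrier (?P (Suc k))"
  have "restrict (x \<otimes>\<^bsub>?P (Suc k)\<^esub> y) {..<k} = restrict x {..<k} \<otimes>\<^bsub>?P k\<^esub> restrict y {..<k}"
    by (simp add: restrict_def fun_eq_iff)
  then have f_mult: "f (restrict (x \<otimes>\<^bsub>?P (Suc k)\<^esub> y) {..<k}) = f (restrict x {..<k}) \<otimes>\<^bsub>H\<^esub> f (restrict y {..<k})"
    using hom_mult[OF f res[OF x] res[OF y]] by simp
  have "x k \<in> {0..<2}" "y k \<in> {0..<2}"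
    using x y by (auto simp: carrier_integer_mod_group PiE_iff)
  then have xy01: "x k = 0 \<or> x k = 1" "y k = 0 \<or> y k = 1"
    by auto
  define u v where "u = f (restrict x {..<k})" and "v = f (restrict y {..<k})"
  have uv: "u \<in> carrier H" "v \<in> carrier H"
    using fH[OF res[OF x]] fH[OF res[OF y]] by (simp_all add: u_def v_def)
  \<comment> \<open>For the case in which both new coordinates are 1: they add up to 0 modulo 2, and
    the two copies of \<open>z\<close> cancel.\<close>
  have "z \<otimes>\<^bsub>H\<^esub> (u \<otimes>\<^bsub>H\<^esub> (z \<otimes>\<^bsub>H\<^esub> v)) = (z \<otimes>\<^bsub>H\<^esub> z) \<otimes>\<^bsub>H\<^esub> (u \<otimes>\<^bsub>H\<^esub> v)"
    using uv z by (simp add: m_ac)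
  then have zz: "z \<otimes>\<^bsub>H\<^esub> (u \<otimes>\<^bsub>H\<^esub> (z \<otimes>\<^bsub>H\<^esub> v)) = u \<otimes>\<^bsub>H\<^esub> v"
    using uv z by (simp add: sq)
  have zl: "u \<otimes>\<^bsub>H\<^esub> (z \<otimes>\<^bsub>H\<^esub> v) = z \<otimes>\<^bsub>H\<^esub> (u \<otimes>\<^bsub>H\<^esub> v)"
    using uv z by (simp add: m_ac)
  have g: "g x = (if x k = 0 then \<one>\<^bsub>H\<^esub> else z) \<otimes>\<^bsub>H\<^esub> u" "g y = (if y k = 0 then \<one>\<^bsub>H\<^esub> else z) \<otimes>\<^bsub>H\<^esub> v"
    "g (x \<otimes>\<^bsub>?P (Suc k)\<^esub> y) = (if (x k + y k) mod 2 = 0 then \<one>\<^bsub>H\<^esub> else z) \<otimes>\<^bsub>H\<^esub> (u \<otimes>\<^bsub>H\<^esub> v)"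
    unfolding g_def f_mult by (simp_all add: u_def v_def)
  show "g (x \<otimes>\<^bsub>?P (Suc k)\<^esub> y) = g x \<otimes>\<^bsub>H\<^esub> g y"
    using xy01 uv z zz zl unfolding g by (elim disjE) (simp_all add: m_assoc)
qed

text \<open>Induction on the order: a subgroup of index 2 avoiding some \<open>z\<close> is a
  smaller group, and \<open>z\<close> supplies one more coordinate.\<close>

lemma finite_elementary_abelian_2_iso:
  assumes "elementary_abelian_2_group H" "finite (carrier H)"
  shows "\<exists>k :: nat. product_group {..<k} (\<lambda>_. integer_mod_group 2) \<cong> H"
  using assms
proof (induction "card (carrier H)" arbitrary: H rule: less_induct)
  case less
  interpret comm_group H
    using less.prems by (simp add: elementary_abelian_2_group_def)
  have sq: "x \<otimes>\<^bsub>H\<^esub> x = \<one>\<^bsub>H\<^esub>" if "x \<in> carrier H" for x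
    using that less.prems by (simp add: elementary_abelian_2_group_iff)
  let ?P = "\<lambda>k. product_group {..<k :: nat} (\<lambda>_. integer_mod_group 2)"
  show ?case
  proof (cases "carrier H = {\<one>\<^bsub>H\<^esub>}")
    case True
    have "(\<lambda>_. \<one>\<^bsub>H\<^esub>) \<in> Group.iso (?P 0) H"
      by (rule isoI) (auto simp: hom_def bij_betw_def True)
    then show ?thesis
      using is_isoI by blast
  next
    case False
    then obtain z where z: "z \<in> carrier H" "z \<noteq> \<one>\<^bsub>H\<^esub>"
      by auto
    obtain K where K: "subgroup K H" "z \<notin> K"
      and zK: "\<And>x. x \<in> carrier H \<Longrightarrow> x \<in> K \<or> z \<otimes>\<^bsub>H\<^esub> x \<in> K"
      using elementary_abelian_2_complement[OF less.prems(1) z] by blast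
    interpret K: subgroup K H by fact
    have "card K < card (carrier H)"
      using less.prems(2) K.subset K(2) z(1) by (intro psubset_card_mono) auto
    then obtain k f where f: "f \<in> Group.iso (?P k) (H\<lparr>carrier := K\<rparr>)"
      using less.hyps[of "H\<lparr>carrier := K\<rparr>"] elementary_abelian_2_subgroup[OF K(1) less.prems(1)]
        finite_subset[OF K.subset less.prems(2)] by (auto simp: is_iso_def)
    have f_hom: "f \<in> hom (?P k) (H\<lparr>carrier := K\<rparr>)" and f_inj: "inj_on f (carrier (?P k))"
      and f_img: "f ` carrier (?P k) = K"
      using f by (auto simp: iso_def bij_betw_def)
    define g where "g x = (if x k = (0 :: int) then \<one>\<^bsub>H\<^esub> else z) \<otimes>\<^bsub>H\<^esub> f (restrict x {..<k})" for x
    have g_hom: "g \<in> hom (?P (Suc k)) H"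
      using elementary_abelian_2_index_2_hom[OF less.prems(1) z(1) K(1) f_hom]
      unfolding g_def by simp
    have g: "group_hom (?P (Suc k)) H g"
      using g_hom by (simp add: group_hom_def group_hom_axioms_def)
    have "g \<in> Group.iso (?P (Suc k)) H"
      unfolding group_hom.iso_iff[OF g]
    proof (intro conjI subsetI ballI impI)
      fix y assume y: "y \<in> carrier H"
      \<comment> \<open>Splits \<open>y\<close> as the \<open>c\<close>-th power of \<open>z\<close>
        times an element \<open>y'\<close> of \<open>K\<close>.\<close>
      define c :: int where "c = (if y \<in> K then 0 else 1)"
      define y' where "y' = (if y \<in> K then y else z \<otimes>\<^bsub>H\<^esub> y)"
      have "y' \<in> K"
        using zK[OF y] by (auto simp: y'_def)
      then obtain x where x: "x \<in> carrier (?P k)" "f x = y'"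
        using f_img by auto
      have "restrict (x(k := c)) {..<k} = x"
        using x(1) by (intro extensionalityI[of _ "{..<k}"]) (simp_all add: PiE_iff)
      then have "g (x(k := c)) = y"
        using y z(1) x(2) by (auto simp: g_def c_def y'_def sq simp flip: m_assoc)
      moreover have "x(k := c) \<in> carrier (?P (Suc k))"
        using x(1) by (auto simp: c_def lessThan_Suc carrier_integer_mod_group PiE_iff extensional_def)
      ultimately show "y \<in> g ` carrier (?P (Suc k))"
        by blast
    next
      fix x assume x: "x \<in> carrier (?P (Suc k))" and gx: "g x = \<one>\<^bsub>H\<^esub>"
      have res: "restrict x {..<k} \<in> carrier (?P k)"
        using x by (simp add: PiE_iff)
      have fK: "f (restrict x {..<k}) \<in> K"
        using imageI[OF res, of f] by (simp only: f_img)
      have "x k = 0"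
      \<comment> \<open>If the last coordinate were 1, \<open>z\<close> would be the inverse of an
        element of \<open>K\<close>, hence in \<open>K\<close>.\<close>
      proof (rule ccontr)
        assume "x k \<noteq> 0"
        then have "z \<otimes>\<^bsub>H\<^esub> f (restrict x {..<k}) = \<one>\<^bsub>H\<^esub>"
          using gx by (simp add: g_def)
        then have "z = inv\<^bsub>H\<^esub> f (restrict x {..<k})"
          using fK K.subset z(1) inv_equality by (metis subsetD)
        then show False
          using K(2) K.m_inv_closed[OF fK] by simp
      qed
      then have "f (restrict x {..<k}) = \<one>\<^bsub>H\<^esub>"
        using gx fK K.subset by (auto simp: g_def)
      moreover have "f \<one>\<^bsub>?P k\<^esub> = \<one>\<^bsub>H\<^esub>"
        using hom_one[OF f_hom] subgroup_imp_group[OF K(1)] by simp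
      moreover have "\<one>\<^bsub>?P k\<^esub> \<in> carrier (?P k)"
        by (intro monoid.one_closed group.is_monoid) simp
      ultimately have "restrict x {..<k} = \<one>\<^bsub>?P k\<^esub>"
        using inj_onD[OF f_inj _ res] by simp
      then have "restrict x {..<k} i = (\<lambda>i\<in>{..<k}. 0) i" for i
        by simp
      then have "x i = 0" if "i < k" for i
        using that by (metis lessThan_iff restrict_apply')
      then have "x i = \<one>\<^bsub>?P (Suc k)\<^esub> i" if "i \<in> {..<Suc k}" for i
        using that \<open>x k = 0\<close> by (cases "i = k") simp_all
      moreover have "x \<in> extensional {..<Suc k}"
        using x by (simp add: PiE_iff)
      moreover have "\<one>\<^bsub>?P (Suc k)\<^esub> \<in> extensional {..<Suc k}"
        by simp
      ultimately show "x = \<one>\<^bsub>?P (Suc k)\<^esub>"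
        by (intro extensionalityI[of x "{..<Suc k}"])
    qed
    then show ?thesis
      using is_isoI by blast
  qed
qed

section \<open>The quaternion group as a direct factor\<close>

fun hamilton_conj :: "int \<times> int \<times> int \<times> int \<Rightarrow> int \<times> int \<times> int \<times> int" where
  "hamilton_conj (a, b, c, d) = (a, - b, - c, - d)"

lemma carrier_Q8:
  "carrier Q8 = {(1, 0, 0, 0), (-1, 0, 0, 0), (0, 1, 0, 0), (0, -1, 0, 0),
                 (0, 0, 1, 0), (0, 0, -1, 0), (0, 0, 0, 1), (0, 0, 0, -1)}"
  and mult_Q8: "monoid.mult Q8 = hamilton_mult"
  and one_Q8: "\<one>\<^bsub>Q8\<^esub> = (1, 0, 0, 0)"
  by (simp_all add: Q8_def)

text \<open>Elements of \<open>Q8\<close> have norm 1, so their inverses are their conjugates. With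
  this explicit form, claims about inverses are settled by enumerating the carrier.\<close>

lemma inv_Q8:
  assumes "q \<in> carrier Q8"
  shows "inv\<^bsub>Q8\<^esub> q = hamilton_conj q"
proof -
  have "\<forall>q \<in> carrier Q8. hamilton_conj q \<in> carrier Q8 \<and> hamilton_mult (hamilton_conj q) q = (1, 0, 0, 0)"
    by (simp add: carrier_Q8)
  then show ?thesis
    using assms by (intro group.inv_equality[OF group_Q8]) (simp_all add: mult_Q8 one_Q8)
qed

lemma conj_self_or_inv_Q8: "group.conj_self_or_inv Q8"
proof -
  have "\<forall>g \<in> carrier Q8. \<forall>x \<in> carrier Q8.
      hamilton_mult (hamilton_mult g x) (hamilton_conj g) = x \<or>
      hamilton_mult (hamilton_mult g x) (hamilton_conj g) = hamilton_conj x"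
    by (simp add: carrier_Q8)
  then show ?thesis
    by (simp add: group.conj_self_or_inv_def[OF group_Q8] inv_Q8 mult_Q8)
qed

text \<open>In \<open>H\<close> conjugation and inversion are both trivial, so the second coordinate
  fits either alternative and the first one decides.\<close>

lemma conj_self_or_inv_Q8_DirProd:
  assumes "elementary_abelian_2_group H"
  shows "group.conj_self_or_inv (Q8 \<times>\<times> H)"
proof -
  interpret Q: group Q8 by (rule group_Q8)
  interpret H: comm_group H
    using assms by (simp add: elementary_abelian_2_group_def)
  interpret P: group "Q8 \<times>\<times> H"
    by (rule DirProd_group) (rule Q.is_group H.is_group)+
  have H_inv: "inv\<^bsub>H\<^esub> y = y" if "y \<in> carrier H" for y
    using that assms H.inv_equality by (auto simp: elementary_abelian_2_group_iff)
  have H_conj: "h \<otimes>\<^bsub>H\<^esub> y \<otimes>\<^bsub>H\<^esub> h = y" if "h \<in> carrier H" "y \<in> carrier H" for h y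
    using that by (metis H.inv_solve_right H.m_closed H.m_comm H_inv)
  show ?thesis
    unfolding P.conj_self_or_inv_def
  proof (intro ballI)
    fix p r assume "p \<in> carrier (Q8 \<times>\<times> H)" "r \<in> carrier (Q8 \<times>\<times> H)"
    then obtain g h x y where gh: "p = (g, h)" "g \<in> carrier Q8" "h \<in> carrier H"
      and xy: "r = (x, y)" "x \<in> carrier Q8" "y \<in> carrier H"
      by (metis SigmaE carrier_DirProd)
    have "g \<otimes>\<^bsub>Q8\<^esub> x \<otimes>\<^bsub>Q8\<^esub> inv\<^bsub>Q8\<^esub> g = x \<or> g \<otimes>\<^bsub>Q8\<^esub> x \<otimes>\<^bsub>Q8\<^esub> inv\<^bsub>Q8\<^esub> g = inv\<^bsub>Q8\<^esub> x"
      using conj_self_or_inv_Q8 gh(2) xy(2) unfolding Q.conj_self_or_inv_def by blast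
    moreover have "inv\<^bsub>Q8 \<times>\<times> H\<^esub> p = (inv\<^bsub>Q8\<^esub> g, h)" "inv\<^bsub>Q8 \<times>\<times> H\<^esub> r = (inv\<^bsub>Q8\<^esub> x, y)"
      using gh xy by (simp_all add: inv_DirProd[OF Q.is_group H.is_group] H_inv)
    ultimately show "p \<otimes>\<^bsub>Q8 \<times>\<times> H\<^esub> r \<otimes>\<^bsub>Q8 \<times>\<times> H\<^esub> inv\<^bsub>Q8 \<times>\<times> H\<^esub> p = r \<or>
        p \<otimes>\<^bsub>Q8 \<times>\<times> H\<^esub> r \<otimes>\<^bsub>Q8 \<times>\<times> H\<^esub> inv\<^bsub>Q8 \<times>\<times> H\<^esub> p = inv\<^bsub>Q8 \<times>\<times> H\<^esub> r"
      using gh xy by (simp add: H_conj)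
  qed
qed

section \<open>Relations of a non-commuting pair and the map from \<open>Q8\<close>\<close>

locale quaternion_pair = group +
  fixes a b
  assumes ab_carrier [simp]: "a \<in> carrier G" "b \<in> carrier G"
    and noncomm: "a \<otimes> b \<noteq> b \<otimes> a"
    and aba: "a \<otimes> b \<otimes> a = b"
    and bab: "b \<otimes> a \<otimes> b = a"
begin

text \<open>The counterpart of -1: it is also the square of \<open>b\<close>, has order 2 and
  commutes with \<open>a\<close> and \<open>b\<close>.\<close>

definition z where "z = a \<otimes> a"

lemma z_carrier [simp]: "z \<in> carrier G"
  by (simp add: z_def)

lemma bb: "b \<otimes> b = z"
proof -
  have "b \<otimes> b = (a \<otimes> b \<otimes> a) \<otimes> b"
    by (simp add: aba)
  also have "\<dots> = a \<otimes> (b \<otimes> a \<otimes> b)"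
    by (simp add: m_assoc)
  finally show ?thesis
    by (simp add: bab z_def)
qed

lemma ba: "b \<otimes> a = z \<otimes> (a \<otimes> b)"
proof -
  have "b \<otimes> a = b \<otimes> (b \<otimes> a \<otimes> b)"
    by (simp add: bab)
  also have "\<dots> = (b \<otimes> b) \<otimes> (a \<otimes> b)"
    by (simp add: m_assoc)
  finally show ?thesis
    by (simp add: bb)
qed

lemma zz: "z \<otimes> z = \<one>"
proof -
  have "a \<otimes> b = a \<otimes> (a \<otimes> b \<otimes> a)"
    by (simp add: aba)
  also have "\<dots> = z \<otimes> (b \<otimes> a)"
    by (simp add: z_def m_assoc)
  also have "\<dots> = z \<otimes> z \<otimes> (a \<otimes> b)"
    by (simp add: ba m_assoc)
  finally show ?thesis
    by simp
qed

lemma z_neq_one: "z \<noteq> \<one>"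
proof
  assume "z = \<one>"
  then have "b \<otimes> a = a \<otimes> b"
    unfolding ba by simp
  then show False
    using noncomm by simp
qed

lemma az: "a \<otimes> z = z \<otimes> a"
  by (simp add: z_def m_assoc)

lemma bz: "b \<otimes> z = z \<otimes> b"
  by (simp add: bb [symmetric] m_assoc)

text \<open>\<open>m_assoc\<close> nests products to the right, so each relation is also needed in
  front of a further factor \<open>x\<close>.\<close>

lemma normal_form_left:
  assumes "x \<in> carrier G"
  shows "a \<otimes> (a \<otimes> x) = z \<otimes> x" "b \<otimes> (b \<otimes> x) = z \<otimes> x" "z \<otimes> (z \<otimes> x) = x"
    "a \<otimes> (z \<otimes> x) = z \<otimes> (a \<otimes> x)" "b \<otimes> (z \<otimes> x) = z \<otimes> (b \<otimes> x)"
    "b \<otimes> (a \<otimes> x) = z \<otimes> (a \<otimes> (b \<otimes> x))"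
  using assms by (simp_all add: bb ba zz az bz flip: m_assoc) (simp_all add: z_def)

text \<open>Rewriting with these rules brings every word in \<open>a\<close>, \<open>b\<close>, \<open>z\<close> into the form \<open>z\<^sup>r a\<^sup>s b\<^sup>t\<close>
  with \<open>r, s, t \<le> 1\<close>.\<close>

lemmas normal_form = m_assoc z_def [symmetric] bb ba zz az bz normal_form_left

text \<open>Sends -1, i, j, k to \<open>z\<close>, \<open>a\<close>, \<open>b\<close>,
  \<open>a \<otimes> b\<close>. The last \<open>else\<close> serves -k and all quadruples outside
  \<open>Q8\<close>, so every value lies in \<open>G\<close>.\<close>

definition of_Q8 :: "int \<times> int \<times> int \<times> int \<Rightarrow> 'a" where
  "of_Q8 q =
    (if q = (1, 0, 0, 0) then \<one> else if q = (-1, 0, 0, 0) then z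
     else if q = (0, 1, 0, 0) then a else if q = (0, -1, 0, 0) then z \<otimes> a
     else if q = (0, 0, 1, 0) then b else if q = (0, 0, -1, 0) then z \<otimes> b
     else if q = (0, 0, 0, 1) then a \<otimes> b else z \<otimes> (a \<otimes> b))"

lemma of_Q8_carrier [simp]: "of_Q8 q \<in> carrier G"
  by (simp add: of_Q8_def)

lemma of_Q8_simps:
  "of_Q8 (1, 0, 0, 0) = \<one>" "of_Q8 (-1, 0, 0, 0) = z"
  "of_Q8 (0, 1, 0, 0) = a" "of_Q8 (0, -1, 0, 0) = z \<otimes> a"
  "of_Q8 (0, 0, 1, 0) = b" "of_Q8 (0, 0, -1, 0) = z \<otimes> b"
  "of_Q8 (0, 0, 0, 1) = a \<otimes> b" "of_Q8 (0, 0, 0, -1) = z \<otimes> (a \<otimes> b)"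
  by (simp_all add: of_Q8_def)

text \<open>\<open>a\<close>, \<open>b\<close>, \<open>z\<close> obey the rules for i, j, -1, in
  particular ji = -ij, so the normal forms agree for all 64 products.\<close>

lemma of_Q8_mult:
  assumes "p \<in> carrier Q8" "q \<in> carrier Q8"
  shows "of_Q8 (p \<otimes>\<^bsub>Q8\<^esub> q) = of_Q8 p \<otimes> of_Q8 q"
proof -
  have "\<forall>p \<in> carrier Q8. \<forall>q \<in> carrier Q8. of_Q8 (hamilton_mult p q) = of_Q8 p \<otimes> of_Q8 q"
    by (simp add: carrier_Q8 of_Q8_simps normal_form)
  then show ?thesis
    using assms by (simp add: mult_Q8)
qed

definition cent where "cent = {c \<in> carrier G. a \<otimes> c = c \<otimes> a \<and> b \<otimes> c = c \<otimes> b}"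

lemma cent_subgroup: "subgroup cent G"
proof (rule subgroupI)
  show "cent \<subseteq> carrier G" "cent \<noteq> {}"
    by (auto simp: cent_def intro: exI[of _ \<one>])
  show "inv x \<in> cent" if "x \<in> cent" for x
    using that by (simp add: cent_def inv_solve_left inv_solve_right flip: m_assoc)
  show "x \<otimes> y \<in> cent" if "x \<in> cent" "y \<in> cent" for x y
  proof -
    have "e \<otimes> (x \<otimes> y) = x \<otimes> y \<otimes> e" if "e \<in> carrier G" "e \<otimes> x = x \<otimes> e" "e \<otimes> y = y \<otimes> e" for e
      using that \<open>x \<in> cent\<close> \<open>y \<in> cent\<close> by (metis (no_types, lifting) cent_def m_assoc mem_Collect_eq)
    then show ?thesis
      using that by (simp add: cent_def)
  qed
qed

text \<open>Each of the other six elements picks up a factor \<open>z\<close> when moved past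
  \<open>a\<close> or \<open>b\<close>. Identifying \<open>q\<close> itself in the first alternative
  is what later gives injectivity.\<close>

lemma of_Q8_in_cent:
  assumes "q \<in> carrier Q8" "of_Q8 q \<in> cent"
  shows "of_Q8 q = \<one> \<and> q = \<one>\<^bsub>Q8\<^esub> \<or> of_Q8 q = z"
proof -
  have "\<forall>q \<in> carrier Q8. of_Q8 q \<in> cent \<longrightarrow> q = (1, 0, 0, 0) \<or> of_Q8 q = z"
    by (simp add: carrier_Q8 of_Q8_simps cent_def normal_form z_neq_one)
  then show ?thesis
    using assms by (auto simp: one_Q8 of_Q8_simps)
qed

end

section \<open>The centralizer of \<open>a\<close> and \<open>b\<close> and the direct
  decomposition\<close>

context quaternion_pair
begin

lemma z_in_cent: "z \<in> cent"
  by (simp add: cent_def az bz)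

lemma of_Q8_cent_commute:
  assumes "c \<in> cent"
  shows "c \<otimes> of_Q8 q = of_Q8 q \<otimes> c"
proof -
  have c: "c \<in> carrier G" "c \<otimes> a = a \<otimes> c" "c \<otimes> b = b \<otimes> c"
    using assms by (simp_all add: cent_def)
  have left: "c \<otimes> (a \<otimes> x) = a \<otimes> (c \<otimes> x)" "c \<otimes> (b \<otimes> x) = b \<otimes> (c \<otimes> x)" if "x \<in> carrier G" for x
    using c that by (simp_all flip: m_assoc)
  have "c \<otimes> z = z \<otimes> c"
    using c by (simp add: z_def left m_assoc)
  then have "c \<otimes> (z \<otimes> x) = z \<otimes> (c \<otimes> x)" if "x \<in> carrier G" for x
    using c(1) that by (simp flip: m_assoc)
  with \<open>c \<otimes> z = z \<otimes> c\<close> show ?thesis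
    using c left by (simp add: of_Q8_def m_assoc)
qed

lemma cent_involution:
  assumes conj_self_or_inv "c \<in> cent"
  shows "c \<otimes> c = \<one>"
proof -
  have c: "c \<in> carrier G" "c \<otimes> a = a \<otimes> c" "c \<otimes> b = b \<otimes> c"
    using assms(2) by (simp_all add: cent_def)
  \<comment> \<open>If \<open>b\<close> commuted with \<open>a \<otimes> c\<close>, cancelling
    \<open>c\<close> would make \<open>a\<close> and \<open>b\<close> commute; so conjugation by
    \<open>b\<close> inverts \<open>a \<otimes> c\<close>.\<close>
  have "b \<otimes> (a \<otimes> c) \<otimes> inv b \<noteq> a \<otimes> c"
  proof
    assume "b \<otimes> (a \<otimes> c) \<otimes> inv b = a \<otimes> c"
    then have "b \<otimes> (a \<otimes> c) = a \<otimes> c \<otimes> b"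
      using c(1) by (metis ab_carrier inv_solve_right m_closed)
    then have "b \<otimes> a \<otimes> c = a \<otimes> b \<otimes> c"
      using c by (simp add: m_assoc)
    then have "b \<otimes> a = a \<otimes> b"
      using c(1) by simp
    then show False
      using noncomm by simp
  qed
  then have "b \<otimes> (a \<otimes> c) \<otimes> inv b = inv (a \<otimes> c)"
    using assms(1) c(1) unfolding conj_self_or_inv_def by (metis ab_carrier m_closed)
  then have "b \<otimes> (a \<otimes> c) = inv (a \<otimes> c) \<otimes> b"
    using c(1) by (metis ab_carrier inv_closed inv_solve_right m_closed)
  \<comment> \<open>Collecting both copies of \<open>c\<close> on the right leaves
    \<open>a \<otimes> b \<otimes> a\<close>, which is \<open>b\<close>, in front of them.\<close>
  then have "b = a \<otimes> c \<otimes> (b \<otimes> (a \<otimes> c))"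
    using c(1) by (metis ab_carrier inv_solve_left m_closed)
  also have "\<dots> = a \<otimes> (c \<otimes> b) \<otimes> (a \<otimes> c)"
    using c(1) by (simp add: m_assoc)
  also have "\<dots> = a \<otimes> b \<otimes> (c \<otimes> a) \<otimes> c"
    using c(1) by (simp add: c(3) m_assoc)
  also have "\<dots> = (a \<otimes> b \<otimes> a) \<otimes> (c \<otimes> c)"
    using c(1) by (simp add: c(2) m_assoc)
  finally have "b = b \<otimes> (c \<otimes> c)"
    by (simp add: aba)
  then show ?thesis
    using c(1) by simp
qed

text \<open>Here \<open>inv y = z \<otimes> y\<close>, so being inverted means picking up the factor
  \<open>z\<close>. Applied to \<open>a\<close> and \<open>b\<close>.\<close>

lemma conj_generator:
  assumes conj_self_or_inv "x \<in> carrier G" "y \<in> carrier G" "y \<otimes> y = z"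
  shows "x \<otimes> y = y \<otimes> x \<or> x \<otimes> y = z \<otimes> (y \<otimes> x)"
proof -
  have "z \<otimes> y \<otimes> y = \<one>"
    using assms by (simp add: m_assoc zz)
  then have "inv y = z \<otimes> y"
    using assms by (intro inv_equality) auto
  then have "x \<otimes> y \<otimes> inv x = y \<or> x \<otimes> y \<otimes> inv x = z \<otimes> y"
    using assms unfolding conj_self_or_inv_def by metis
  then show ?thesis
    using assms by (metis inv_solve_right m_assoc m_closed z_carrier)
qed

text \<open>Moving \<open>x\<close> past \<open>a\<close> and past \<open>b\<close> gives two signs.
  Multiplying by \<open>a\<close> changes only the sign for \<open>b\<close>, by \<open>b\<close>
  only that for \<open>a\<close>, by \<open>a \<otimes> b\<close> both.\<close>

lemma of_Q8_cent_decomposition: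
  assumes C: conj_self_or_inv and x: "x \<in> carrier G"
  obtains q c where "q \<in> carrier Q8" "c \<in> cent" "x = of_Q8 q \<otimes> c"
proof -
  have "x \<otimes> a = a \<otimes> x \<or> x \<otimes> a = z \<otimes> (a \<otimes> x)" "x \<otimes> b = b \<otimes> x \<or> x \<otimes> b = z \<otimes> (b \<otimes> x)"
    using conj_generator[OF C x] bb z_def by auto
  then consider "x \<otimes> a = a \<otimes> x" "x \<otimes> b = b \<otimes> x" | "x \<otimes> a = a \<otimes> x" "x \<otimes> b = z \<otimes> (b \<otimes> x)"
    | "x \<otimes> a = z \<otimes> (a \<otimes> x)" "x \<otimes> b = b \<otimes> x"
    | "x \<otimes> a = z \<otimes> (a \<otimes> x)" "x \<otimes> b = z \<otimes> (b \<otimes> x)"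
    by blast
  then show thesis
  proof cases
    case 1
    show thesis
      by (rule that[of "(1, 0, 0, 0)" x]) (use x 1 in \<open>simp_all add: carrier_Q8 of_Q8_simps cent_def\<close>)
  next
    case 2
    show thesis
      \<comment> \<open>Each of \<open>a\<close>, \<open>b\<close>, \<open>a \<otimes> b\<close> has
        square \<open>z\<close>, so the compensating inverse is the image of -i here, and of -j and
        -k below.\<close>
      by (rule that[of "(0, -1, 0, 0)" "a \<otimes> x"])
        (use x 2 in \<open>simp_all add: carrier_Q8 of_Q8_simps cent_def normal_form\<close>)
  next
    case 3
    show thesis
      by (rule that[of "(0, 0, -1, 0)" "b \<otimes> x"])
        (use x 3 in \<open>simp_all add: carrier_Q8 of_Q8_simps cent_def normal_form\<close>)
  next
    case 4
    show thesis
      by (rule that[of "(0, 0, 0, -1)" "a \<otimes> (b \<otimes> x)"])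
        (use x 4 in \<open>simp_all add: carrier_Q8 of_Q8_simps cent_def normal_form\<close>)
  qed
qed

text \<open>\<open>H\<close> commutes with the image of \<open>Q8\<close> and together with it fills
  \<open>G\<close>. They meet trivially, since only \<open>\<one>\<close> and \<open>z\<close> of
  that image lie in \<open>cent\<close> and \<open>z\<close> is not in \<open>H\<close>.\<close>

lemma of_Q8_DirProd_iso:
  assumes C: conj_self_or_inv and H: "subgroup H G" "H \<subseteq> cent" "z \<notin> H"
    and zH: "\<And>c. c \<in> cent \<Longrightarrow> c \<in> H \<or> z \<otimes> c \<in> H"
    and K: "group K" "carrier K = H" "monoid.mult K = monoid.mult G" "\<one>\<^bsub>K\<^esub> = \<one>"
  shows "(\<lambda>(q, h). of_Q8 q \<otimes> h) \<in> Group.iso (Q8 \<times>\<times> K) G"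
proof -
  interpret H: subgroup H G by fact
  let ?f = "\<lambda>(q, h). of_Q8 q \<otimes> h"
  have "?f \<in> hom (Q8 \<times>\<times> K) G"
  proof (rule homI)
    show "?f x \<in> carrier G" if "x \<in> carrier (Q8 \<times>\<times> K)" for x
      using that by (auto simp: K)
    fix x y assume "x \<in> carrier (Q8 \<times>\<times> K)" "y \<in> carrier (Q8 \<times>\<times> K)"
    then obtain q h r k where xy: "x = (q, h)" "y = (r, k)"
      and q: "q \<in> carrier Q8" "r \<in> carrier Q8" and h: "h \<in> H" "k \<in> H"
      by (cases x, cases y) (auto simp: K)
    have hG: "h \<in> carrier G" "k \<in> carrier G"
      using h by auto
    have comm: "of_Q8 r \<otimes> h = h \<otimes> of_Q8 r"
      using of_Q8_cent_commute h(1) H(2) by (simp add: subsetD)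
    have "of_Q8 q \<otimes> of_Q8 r \<otimes> (h \<otimes> k) = of_Q8 q \<otimes> (of_Q8 r \<otimes> h) \<otimes> k"
      using hG by (simp add: m_assoc)
    also have "\<dots> = of_Q8 q \<otimes> h \<otimes> (of_Q8 r \<otimes> k)"
      unfolding comm using hG by (simp add: m_assoc)
    finally show "?f (x \<otimes>\<^bsub>Q8 \<times>\<times> K\<^esub> y) = ?f x \<otimes> ?f y"
      using q by (simp add: xy K of_Q8_mult)
  qed
  then have hom: "group_hom (Q8 \<times>\<times> K) G ?f"
    using group_axioms DirProd_group[OF group_Q8 K(1)]
    by (simp add: group_hom_def group_hom_axioms_def)
  show ?thesis
    unfolding group_hom.iso_iff[OF hom]
  proof (intro conjI subsetI ballI impI)
    fix x assume "x \<in> carrier G"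
    then obtain q c where q: "q \<in> carrier Q8" and c: "c \<in> cent" and x: "x = of_Q8 q \<otimes> c"
      using of_Q8_cent_decomposition[OF C] by blast
    have cG: "c \<in> carrier G"
      using c by (simp add: cent_def)
    show "x \<in> ?f ` carrier (Q8 \<times>\<times> K)"
    proof (cases "c \<in> H")
      case True
      then show ?thesis
        using q x by (intro image_eqI[of _ _ "(q, c)"]) (auto simp: K)
    next
      case False
      have m1: "(-1, 0, 0, 0) \<in> carrier Q8"
        by (simp add: carrier_Q8)
      \<comment> \<open>Of the two inserted copies of \<open>z\<close>, one moves \<open>c\<close>
        into \<open>H\<close> and the other is absorbed into the quaternion as -1.\<close>
      have "x = of_Q8 q \<otimes> (z \<otimes> (z \<otimes> c))"
        using cG by (simp add: x normal_form_left)
      also have "\<dots> = of_Q8 (q \<otimes>\<^bsub>Q8\<^esub> (-1, 0, 0, 0)) \<otimes> (z \<otimes> c)"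
        using cG by (simp add: of_Q8_mult[OF q m1] of_Q8_simps m_assoc)
      finally have "x = ?f (q \<otimes>\<^bsub>Q8\<^esub> (-1, 0, 0, 0), z \<otimes> c)"
        by simp
      moreover have "q \<otimes>\<^bsub>Q8\<^esub> (-1, 0, 0, 0) \<in> carrier Q8"
        using q m1 group_Q8 by (intro monoid.m_closed group.is_monoid)
      ultimately show ?thesis
        using zH[OF c] False by (intro image_eqI) (auto simp: K)
    qed
  next
    fix x assume "x \<in> carrier (Q8 \<times>\<times> K)" and fx: "?f x = \<one>"
    then obtain q h where x: "x = (q, h)" "q \<in> carrier Q8" "h \<in> H"
      by (cases x) (auto simp: K)
    have "inv h = of_Q8 q"
      using fx x by (intro inv_equality) auto
    then have "of_Q8 q \<in> H"
      using H.m_inv_closed[OF x(3)] by simp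
    then have "of_Q8 q \<in> cent" "of_Q8 q \<noteq> z"
      using H(2,3) by (blast, metis)
    then have "of_Q8 q = \<one>" "q = \<one>\<^bsub>Q8\<^esub>"
      using of_Q8_in_cent[OF x(2)] by blast+
    moreover have "h \<in> carrier G"
      using x(3) by simp
    ultimately show "x = \<one>\<^bsub>Q8 \<times>\<times> K\<^esub>"
      using fx x(1) by (simp add: K(4))
  qed
qed

end

lemma (in group) noncomm_conj_self_or_inv_imp_Q8_factor:
  assumes C: conj_self_or_inv and nc: "\<not> comm_group G"
  shows "\<exists>K :: 'a monoid. elementary_abelian_2_group K \<and> G \<cong> Q8 \<times>\<times> K"
proof -
  obtain a b where ab: "a \<in> carrier G" "b \<in> carrier G" "a \<otimes> b \<noteq> b \<otimes> a"
    using nc group_comm_groupI by blast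
  \<comment> \<open>The inverse-free form of the fact that \<open>y\<close> conjugates
    \<open>x\<close> to \<open>inv x\<close>. Used in both orders, it gives the two relations of
    \<open>quaternion_pair\<close>.\<close>
  have inverts: "x \<otimes> y \<otimes> x = y"
    if xy: "x \<in> carrier G" "y \<in> carrier G" "x \<otimes> y \<noteq> y \<otimes> x" for x y
  proof -
    have "y \<otimes> x \<otimes> inv y \<noteq> x"
      using xy by (metis inv_solve_right m_closed)
    then have "y \<otimes> x \<otimes> inv y = inv x"
      using C xy unfolding conj_self_or_inv_def by blast
    then have "y \<otimes> x = inv x \<otimes> y"
      using xy by (metis inv_closed inv_solve_right m_closed)
    then have "y = x \<otimes> (y \<otimes> x)"
      using xy by (metis inv_solve_left m_closed)
    then show ?thesis
      using xy by (simp add: m_assoc)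
  qed
  interpret quaternion_pair G a b
    using ab inverts[of a b] inverts[of b a] by unfold_locales auto
  have E: "elementary_abelian_2_group (G\<lparr>carrier := cent\<rparr>)"
    using cent_involution[OF C] subgroup_imp_group[OF cent_subgroup]
    by (simp add: elementary_abelian_2_group_iff)
  have z: "z \<in> carrier (G\<lparr>carrier := cent\<rparr>)" "z \<noteq> \<one>\<^bsub>G\<lparr>carrier := cent\<rparr>\<^esub>"
    using z_in_cent z_neq_one by simp_all
  obtain H where H: "subgroup H (G\<lparr>carrier := cent\<rparr>)" "z \<notin> H"
    and zH: "\<And>c. c \<in> cent \<Longrightarrow> c \<in> H \<or> z \<otimes> c \<in> H"
    using elementary_abelian_2_complement[OF E z] by simp metis
  have H_sub: "H \<subseteq> cent"
    using subgroup.subset[OF H(1)] by simp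
  have HG: "subgroup H G"
    using incl_subgroup[OF cent_subgroup H(1)] .
  interpret H: subgroup H G by fact
  \<comment> \<open>A plain record, because the claim asks for an \<open>'a monoid\<close>, without
    the possible extra fields of \<open>G\<close>.\<close>
  define K where "K = \<lparr>carrier = H, monoid.mult = monoid.mult G, one = \<one>\<rparr>"
  have "group K"
  proof (rule groupI)
    show "\<exists>y\<in>carrier K. y \<otimes>\<^bsub>K\<^esub> x = \<one>\<^bsub>K\<^esub>" if "x \<in> carrier K" for x
      using that by (intro bexI[of _ "inv x"]) (simp_all add: K_def)
  qed (simp_all add: K_def m_assoc)
  moreover have "x \<otimes> x = \<one>" if "x \<in> H" for x
    using cent_involution[OF C] H_sub that by blast
  ultimately have K: "elementary_abelian_2_group K"
    by (simp add: elementary_abelian_2_group_iff K_def)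
  have "Q8 \<times>\<times> K \<cong> G"
    using of_Q8_DirProd_iso[OF C HG H_sub H(2) zH \<open>group K\<close>]
    by (intro is_isoI) (simp add: K_def)
  then have "G \<cong> Q8 \<times>\<times> K"
    using group.iso_sym[OF DirProd_group[OF group_Q8 \<open>group K\<close>]] by blast
  then show ?thesis
    using K by blast
qed

section \<open>Counting induced partitions\<close>

text \<open>Indexed by attained values instead of points: distinct values have distinct fibers, so
  classes are counted by values.\<close>

definition level_sets :: "'a set \<Rightarrow> ('a \<Rightarrow> 'b) \<Rightarrow> 'a set set" where
  "level_sets A f = (\<lambda>v. {x \<in> A. f x = v}) ` f ` A"

lemma quotient_kernel_eq_level_sets:
  "A // {(x, y). x \<in> A \<and> y \<in> A \<and> f x = f y} = level_sets A f"
proof -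
  have "{(x, y). x \<in> A \<and> y \<in> A \<and> f x = f y} `` {x} = {y \<in> A. f y = f x}" if "x \<in> A" for x
    using that by auto
  then show ?thesis
    by (auto simp: quotient_def level_sets_def)
qed

lemma inj_on_fiber: "inj_on (\<lambda>v. {x \<in> A. f x = v}) (f ` A)"
  by (rule inj_onI) blast

lemma card_level_sets: "card (level_sets A f) = card (f ` A)"
  unfolding level_sets_def by (rule card_image[OF inj_on_fiber])

lemma partition_on_level_sets: "partition_on A (level_sets A f)"
  by (auto simp: level_sets_def partition_on_def disjoint_def)

text \<open>Number the finitely many blocks: 1 + 1/(1 + n) separates the numbers and stays in
  [1, 2], where the triangle inequality is automatic.\<close>

lemma partition_on_imp_level_sets:
  assumes P: "partition_on A P" and "finite P"
  obtains c :: "'a \<Rightarrow> real" where "\<And>x. 1 \<le> c x \<and> c x \<le> 2" "P = level_sets A c"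
proof -
  obtain n :: "'a set \<Rightarrow> nat" where n: "inj_on n P"
    using finite_imp_inj_to_nat_seg[OF \<open>finite P\<close>] by blast
  \<comment> \<open>Unspecified for points in no block, which is harmless: the bounds on
    \<open>c\<close> hold for any number.\<close>
  define block where "block x = (THE B. B \<in> P \<and> x \<in> B)" for x
  define c :: "'a \<Rightarrow> real" where "c x = 1 + 1 / (1 + real (n (block x)))" for x
  have block: "block x = B" if "B \<in> P" "x \<in> B" for x B
    unfolding block_def using that disjointD[OF partition_onD2[OF P]] by (intro the_equality) blast+
  have c_eq: "c x = c y \<longleftrightarrow> block x = block y" if "block x \<in> P" "block y \<in> P" for x y
    using inj_on_eq_iff[OF n that] by (simp add: c_def)
  have A: "A = \<Union>P"
    using partition_onD1[OF P] .
  have fiber: "{x \<in> A. c x = c y} = B" if "B \<in> P" "y \<in> B" for B y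
  proof (intro equalityI subsetI)
    fix x assume "x \<in> {x \<in> A. c x = c y}"
    then obtain B' where B': "B' \<in> P" "x \<in> B'" "c x = c y"
      unfolding A by blast
    then have "block x = block y"
      using c_eq block that by metis
    then show "x \<in> B"
      using block[OF B'(1,2)] block[OF that] B'(2) by simp
  next
    fix x assume x: "x \<in> B"
    then have "c x = c y"
      using block[OF that(1) x] block[OF that] by (simp add: c_def)
    then show "x \<in> {x \<in> A. c x = c y}"
      using that(1) x unfolding A by blast
  qed
  have "P = level_sets A c"
  proof (intro equalityI subsetI)
    fix B assume B: "B \<in> P"
    moreover have "B \<noteq> {}"
      using B partition_onD3[OF P] by blast
    ultimately obtain y where y: "y \<in> B"
      by blast
    then have "c y \<in> c ` A"
      using B unfolding A by blast
    then show "B \<in> level_sets A c"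
      unfolding level_sets_def using fiber[OF B y] by blast
  next
    fix B assume "B \<in> level_sets A c"
    then obtain y where y: "y \<in> A" "B = {x \<in> A. c x = c y}"
      by (auto simp: level_sets_def)
    then obtain B' where "B' \<in> P" "y \<in> B'"
      unfolding A by blast
    then show "B \<in> P"
      using fiber y(2) by metis
  qed
  moreover have "1 \<le> c x \<and> c x \<le> 2" for x
    by (simp add: c_def)
  ultimately show thesis
    using that by blast
qed

section \<open>Metrics and partitions of the set of inverse pairs\<close>

lemma num_right_invariant_eq_card_image:
  "num_right_invariant G = card (induced_partition G ` {d. right_invariant_metric G d})"
proof -
  have "num_right_invariant G = card (level_sets {d. right_invariant_metric G d} (induced_partition G))"
    unfolding num_right_invariant_def P_equivalent_def
    using quotient_kernel_eq_level_sets[of "{d. right_invariant_metric G d}" "induced_partition G"]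
    by (simp only: mem_Collect_eq)
  then show ?thesis
    by (simp only: card_level_sets)
qed

text \<open>Partitions of \<open>{..<m}\<close> are pulled back along \<open>p\<close>, whose fibers are the classes \<open>{x, x\<^sup>-\<^sup>1}\<close>
  with \<open>x \<noteq> \<one>\<close>.\<close>

lemma (in group) num_right_invariant_eq_Bell:
  fixes p :: "'a \<Rightarrow> nat"
  assumes surj: "p ` (carrier G - {\<one>}) = {..<m}"
    and p_eq: "\<And>x y. x \<in> carrier G - {\<one>} \<Longrightarrow> y \<in> carrier G - {\<one>} \<Longrightarrow>
      p x = p y \<longleftrightarrow> y = x \<or> y = inv x"
  shows "num_right_invariant G = Bell m"
proof -
  let ?A = "carrier G - {\<one>}"
  define F where "F B = {x \<in> ?A. p x \<in> B}" for B
  \<comment> \<open>Only the identity has weight 0, so \<open>{\<one>}\<close> is a block of every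
    induced partition.\<close>
  define \<Phi> where "\<Phi> P = insert {\<one>} (F ` P)" for P
  have img: "p ` F B = B" if "B \<subseteq> {..<m}" for B
  proof -
    have "p ` F B = p ` ?A \<inter> B"
      by (auto simp: F_def)
    then show ?thesis
      using that surj by (simp add: Int_absorb1)
  qed
  have sub: "B \<subseteq> {..<m}" if "partition_on {..<m} P" "B \<in> P" for B P
    using partition_onD1[OF that(1)] that(2) by blast
  \<comment> \<open>\<open>\<Phi>\<close> is undone by dropping the block \<open>{\<one>}\<close>
    and mapping the others forward along \<open>p\<close>.\<close>
  have "inj_on \<Phi> {P. partition_on {..<m} P}"
  proof (rule inj_on_inverseI)
    fix P assume "P \<in> {P. partition_on {..<m} P}"
    then have P: "partition_on {..<m} P"
      by simp
    have "F B \<noteq> {\<one>}" for B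
      by (auto simp: F_def)
    then have "\<Phi> P - {{\<one>}} = F ` P"
      unfolding \<Phi>_def by blast
    then have "(`) p ` (\<Phi> P - {{\<one>}}) = (\<lambda>B. p ` F B) ` P"
      by (simp only: image_image)
    also have "\<dots> = P"
      using img sub[OF P] by simp
    finally show "(`) p ` (\<Phi> P - {{\<one>}}) = P" .
  qed
  then have card_\<Phi>: "card (\<Phi> ` {P. partition_on {..<m} P}) = Bell m"
    by (simp add: Bell_def card_image)
  \<comment> \<open>Both inclusions below rest on this: when the weight factors through
    \<open>p\<close>, its fibers other than \<open>{\<one>}\<close> are pulled back from those of
    \<open>c\<close>.\<close>
  have \<Phi>_level_sets: "induced_partition G d = \<Phi> (level_sets {..<m} c)"
    if d: "right_invariant_metric G d" and w: "\<And>x. x \<in> ?A \<Longrightarrow> weight G d x = c (p x)" for d c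
  proof -
    have one: "weight G d \<one> = 0"
      using weight_one[OF d] .
    have nz: "weight G d x \<noteq> 0" if "x \<in> ?A" for x
      using weight_pos[OF d, of x] that by simp
    have "weight G d ` carrier G = insert (weight G d \<one>) (weight G d ` ?A)"
      by auto
    moreover have "weight G d ` ?A = c ` p ` ?A"
      unfolding image_image by (rule image_cong) (simp_all add: w)
    ultimately have W: "weight G d ` carrier G = insert 0 (c ` {..<m})"
      by (simp only: one surj)
    have zero: "{x \<in> carrier G. weight G d x = 0} = {\<one>}"
      using one nz by auto
    have fib: "{x \<in> carrier G. weight G d x = v} = F {i \<in> {..<m}. c i = v}" if v: "v \<in> c ` {..<m}" for v
    proof -
      obtain x where "x \<in> ?A" "v = c (p x)"
        using v unfolding surj[symmetric] by blast
      then have "v \<noteq> 0"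
        using nz w by metis
      have "y \<in> carrier G \<and> weight G d y = v \<longleftrightarrow> y \<in> ?A \<and> p y \<in> {..<m} \<and> c (p y) = v" for y
      proof (cases "y \<in> ?A")
        case True
        moreover have "p y \<in> {..<m}"
          using surj True by blast
        ultimately show ?thesis
          using w[OF True] by simp
      next
        case False
        then show ?thesis
          using one \<open>v \<noteq> 0\<close> by auto
      qed
      then show ?thesis
        by (simp add: F_def)
    qed
    have "induced_partition G d = level_sets (carrier G) (weight G d)"
      unfolding induced_partition_def
      using quotient_kernel_eq_level_sets[of "carrier G" "weight G d"] by simp
    also have "\<dots> = insert {\<one>} ((\<lambda>v. {x \<in> carrier G. weight G d x = v}) ` c ` {..<m})"
      unfolding level_sets_def W by (simp add: zero)
    also have "\<dots> = insert {\<one>} ((\<lambda>v. F {i \<in> {..<m}. c i = v}) ` c ` {..<m})"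
      using fib by (simp cong: image_cong_simp)
    also have "\<dots> = \<Phi> (level_sets {..<m} c)"
      unfolding \<Phi>_def level_sets_def by (simp add: image_image)
    finally show ?thesis .
  qed
  have "induced_partition G ` {d. right_invariant_metric G d} = \<Phi> ` {P. partition_on {..<m} P}"
  proof (intro equalityI subsetI)
    fix Q assume "Q \<in> induced_partition G ` {d. right_invariant_metric G d}"
    then obtain d where d: "right_invariant_metric G d" and Q: "Q = induced_partition G d"
      by blast
    \<comment> \<open>The choice of preimage does not matter: two preimages of a point are equal or
      mutually inverse, hence of equal weight.\<close>
    define c where "c = weight G d \<circ> inv_into ?A p"
    have "weight G d x = c (p x)" if x: "x \<in> ?A" for x
    proof -
      define y where "y = inv_into ?A p (p x)"
      have y: "y \<in> ?A"
        unfolding y_def using x by (intro inv_into_into imageI)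
      have "p y = p x"
        unfolding y_def using x by (intro f_inv_into_f imageI)
      then have "x = y \<or> x = inv y"
        using p_eq[OF y x] by blast
      then have "weight G d x = weight G d y"
        using weight_inv[OF d, of y] y by auto
      then show ?thesis
        by (simp add: c_def y_def)
    qed
    then have "Q = \<Phi> (level_sets {..<m} c)"
      unfolding Q by (rule \<Phi>_level_sets[OF d])
    then show "Q \<in> \<Phi> ` {P. partition_on {..<m} P}"
      using partition_on_level_sets by blast
  next
    fix Q assume "Q \<in> \<Phi> ` {P. partition_on {..<m} P}"
    then obtain P where P: "partition_on {..<m} P" and Q: "Q = \<Phi> P"
      by blast
    have "finite P"
      using finite_elements[OF finite_lessThan P] .
    then obtain c :: "nat \<Rightarrow> real" where c: "\<And>i. 1 \<le> c i \<and> c i \<le> 2" "P = level_sets {..<m} c"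
      using partition_on_imp_level_sets[OF P] by blast
    define w where "w x = (if x = \<one> then 0 else c (p x))" for x
    have "p (inv x) = p x" if "x \<in> ?A" for x
      using p_eq[of x "inv x"] that by simp
    then have w_inv: "w (inv x) = w x" if "x \<in> carrier G" for x
      using that by (simp add: w_def)
    obtain d where d: "right_invariant_metric G d"
      and dw: "\<And>x. x \<in> carrier G \<Longrightarrow> weight G d x = w x"
      by (rule right_invariant_metric_of_weight[of w]) (use c(1) w_inv in \<open>simp_all add: w_def\<close>)
    have "weight G d x = c (p x)" if "x \<in> ?A" for x
      using dw[of x] that by (simp add: w_def)
    then have "induced_partition G d = Q"
      unfolding Q c(2) by (rule \<Phi>_level_sets[OF d])
    then show "Q \<in> induced_partition G ` {d. right_invariant_metric G d}"
      using d by blast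
  qed
  then show ?thesis
    using card_\<Phi> by (simp add: num_right_invariant_eq_card_image)
qed

section \<open>The number of inverse pairs in \<open>Q8 \<times>\<times> H\<close>\<close>

fun Q8_class :: "int \<times> int \<times> int \<times> int \<Rightarrow> int \<times> int \<times> int \<times> int" where
  "Q8_class (a, b, c, d) = (a, \<bar>b\<bar>, \<bar>c\<bar>, \<bar>d\<bar>)"

text \<open>Inversion negates the imaginary parts, at most one of which is nonzero, so absolute
  values forget exactly inversion; the real part keeps 1 and -1 apart.\<close>

lemma Q8_class_eq_iff:
  assumes "q \<in> carrier Q8" "r \<in> carrier Q8"
  shows "Q8_class q = Q8_class r \<longleftrightarrow> r = q \<or> r = inv\<^bsub>Q8\<^esub> q"
proof -
  have "\<forall>q \<in> carrier Q8. \<forall>r \<in> carrier Q8. Q8_class q = Q8_class r \<longleftrightarrow> r = q \<or> r = hamilton_conj q"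
    by (simp add: carrier_Q8)
  then show ?thesis
    using assms by (simp add: inv_Q8)
qed

lemma card_Q8_class: "card (Q8_class ` carrier Q8) = 5"
  by (simp add: carrier_Q8)

text \<open>Inversion is trivial on \<open>H\<close>, so a class in the product is one of the five
  classes of \<open>Q8\<close> together with an element of \<open>H\<close>. The identity accounts
  for the subtracted 1.\<close>

lemma num_right_invariant_Q8_DirProd:
  assumes G: "group G" and iso: "G \<cong> Q8 \<times>\<times> H"
    and H: "elementary_abelian_2_group H" "finite (carrier H)"
  shows "num_right_invariant G = Bell (5 * card (carrier H) - 1)"
proof -
  interpret G: group G by fact
  interpret H: group H
    using H by (simp add: elementary_abelian_2_group_iff)
  have P: "group (Q8 \<times>\<times> H)"
    using DirProd_group[OF group_Q8 H.is_group] .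
  obtain f where f: "f \<in> Group.iso G (Q8 \<times>\<times> H)"
    using iso by (auto simp: is_iso_def)
  interpret f: group_hom G "Q8 \<times>\<times> H" f
    using f G P by (simp add: group_hom_def group_hom_axioms_def iso_def)
  have f_inj: "inj_on f (carrier G)" and f_img: "f ` carrier G = carrier Q8 \<times> carrier H"
    using f by (simp_all add: iso_def bij_betw_def)
  have H_inv: "inv\<^bsub>H\<^esub> y = y" if "y \<in> carrier H" for y
    using that H H.inv_equality by (auto simp: elementary_abelian_2_group_iff)
  let ?one = "((1, 0, 0, 0) :: int \<times> int \<times> int \<times> int, \<one>\<^bsub>H\<^esub>)"
  define c where "c x = (Q8_class (fst (f x)), snd (f x))" for x
  define C where "C = (Q8_class ` carrier Q8) \<times> carrier H"
  have c_eq: "c x = c y \<longleftrightarrow> y = x \<or> y = inv\<^bsub>G\<^esub> x" if xy: "x \<in> carrier G" "y \<in> carrier G" for x y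
  proof -
    obtain q h r k where fx: "f x = (q, h)" "q \<in> carrier Q8" "h \<in> carrier H"
      and fy: "f y = (r, k)" "r \<in> carrier Q8" "k \<in> carrier H"
    proof -
      have "f x \<in> carrier Q8 \<times> carrier H" "f y \<in> carrier Q8 \<times> carrier H"
        using f_img xy by blast+
      then show thesis
        using that by (cases "f x", cases "f y") auto
    qed
    have "f (inv\<^bsub>G\<^esub> x) = (inv\<^bsub>Q8\<^esub> q, h)"
      using fx xy by (simp add: f.hom_inv inv_DirProd[OF group_Q8 H.is_group] H_inv)
    then have "c x = c y \<longleftrightarrow> f y = f x \<or> f y = f (inv\<^bsub>G\<^esub> x)"
      using fx fy by (auto simp: c_def Q8_class_eq_iff)
    then show ?thesis
      using xy inj_on_eq_iff[OF f_inj] G.inv_closed by metis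
  qed
  have "f \<one>\<^bsub>G\<^esub> = ?one"
    using f.hom_one by (simp add: one_Q8)
  then have c_one: "c \<one>\<^bsub>G\<^esub> = ?one"
    by (simp add: c_def)
  have c_img: "c ` carrier G = C"
  proof -
    have "c ` carrier G = (\<lambda>x. (Q8_class (fst x), snd x)) ` f ` carrier G"
      unfolding image_image c_def ..
    also have "\<dots> = C"
      unfolding f_img C_def by force
    finally show ?thesis .
  qed
  \<comment> \<open>The identity is its own inverse, so no other element shares its value and
    removing it removes exactly one value.\<close>
  have "c x \<noteq> c \<one>\<^bsub>G\<^esub>" if "x \<in> carrier G - {\<one>\<^bsub>G\<^esub>}" for x
    using c_eq[of "\<one>\<^bsub>G\<^esub>" x] that by auto
  then have "c \<one>\<^bsub>G\<^esub> \<notin> c ` (carrier G - {\<one>\<^bsub>G\<^esub>})"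
    by (metis imageE)
  moreover have "C = insert (c \<one>\<^bsub>G\<^esub>) (c ` (carrier G - {\<one>\<^bsub>G\<^esub>}))"
    unfolding c_img[symmetric] image_insert[symmetric] by (simp add: insert_absorb)
  ultimately have c_img': "c ` (carrier G - {\<one>\<^bsub>G\<^esub>}) = C - {?one}"
    unfolding c_one[symmetric] by (metis Diff_insert_absorb)
  have "finite C"
    unfolding C_def using H(2) by (simp add: carrier_Q8)
  then obtain h where h: "bij_betw h (C - {?one}) {..<card (C - {?one})}"
    using finite_same_card_bij[of "C - {?one}" "{..<card (C - {?one})}"] by auto
  have "?one \<in> C"
    using c_img c_one G.one_closed by (metis imageI)
  then have card: "card (C - {?one}) = 5 * card (carrier H) - 1"
    by (simp add: C_def card_cartesian_product card_Q8_class)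
  have "(h \<circ> c) x = (h \<circ> c) y \<longleftrightarrow> y = x \<or> y = inv\<^bsub>G\<^esub> x"
    if xy: "x \<in> carrier G - {\<one>\<^bsub>G\<^esub>}" "y \<in> carrier G - {\<one>\<^bsub>G\<^esub>}" for x y
  proof -
    have "c x \<in> C - {?one}" "c y \<in> C - {?one}"
      using c_img' xy by blast+
    then have "(h \<circ> c) x = (h \<circ> c) y \<longleftrightarrow> c x = c y"
      using inj_on_eq_iff[OF bij_betw_imp_inj_on[OF h]] by simp
    then show ?thesis
      using c_eq xy by simp
  qed
  moreover have "(h \<circ> c) ` (carrier G - {\<one>\<^bsub>G\<^esub>}) = {..<card (C - {?one})}"
    unfolding image_comp [symmetric] c_img' using h by (rule bij_betw_imp_surj_on)
  ultimately show ?thesis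
    using G.num_right_invariant_eq_Bell[of "h \<circ> c"] card by metis
qed

lemma num_bi_invariant_eq_num_right_invariant:
  assumes "\<forall>d. right_invariant_metric G d \<longrightarrow> bi_invariant_metric G d"
  shows "num_bi_invariant G = num_right_invariant G"
proof -
  have "bi_invariant_metric G d \<longleftrightarrow> right_invariant_metric G d" for d
    using assms unfolding bi_invariant_metric_def by blast
  then show ?thesis
    by (simp only: num_bi_invariant_def num_right_invariant_def)
qed

lemma finite_factor_of_DirProd:
  assumes "G \<cong> H \<times>\<times> K" "finite (carrier G)" "group H"
  shows "finite (carrier K)"
proof -
  obtain f where "bij_betw f (carrier G) (carrier H \<times> carrier K)"
    using assms(1) by (auto simp: is_iso_def iso_def)
  then have "finite (carrier H \<times> carrier K)"
    using assms(2) bij_betw_finite by blast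
  moreover have "carrier H \<noteq> {}"
    using assms(3) monoid.one_closed[OF group.is_monoid] by blast
  ultimately show ?thesis
    using finite_cartesian_productD2 by blast
qed

lemma elementary_abelian_2_group_product:
  "elementary_abelian_2_group (product_group A (\<lambda>_. integer_mod_group 2))"
proof -
  have "(x + x) mod 2 = 0" for x :: int
    by presburger
  then show ?thesis
    by (simp add: elementary_abelian_2_group_iff)
qed

theorem theorem6p8:
  fixes G :: "('a, 'm) monoid_scheme"
  assumes "group G"
  shows "((\<forall>d. right_invariant_metric G d \<longrightarrow> bi_invariant_metric G d) \<longleftrightarrow>
            comm_group G \<or>
            (\<exists>H :: 'a monoid. elementary_abelian_2_group H \<and> G \<cong> Q8 \<times>\<times> H)) \<and>
         (finite (carrier G) \<and> \<not> comm_group G \<and>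
            (\<forall>d. right_invariant_metric G d \<longrightarrow> bi_invariant_metric G d) \<longrightarrow>
            (\<exists>k :: nat. G \<cong> Q8 \<times>\<times> product_group {..<k} (\<lambda>_. integer_mod_group 2) \<and>
               num_right_invariant G = Bell (5 * 2 ^ k - 1) \<and>
               num_bi_invariant G = Bell (5 * 2 ^ k - 1)))"
proof (intro conjI impI)
  interpret group G by fact
  show "(\<forall>d. right_invariant_metric G d \<longrightarrow> bi_invariant_metric G d) \<longleftrightarrow>
      comm_group G \<or> (\<exists>H :: 'a monoid. elementary_abelian_2_group H \<and> G \<cong> Q8 \<times>\<times> H)"
    unfolding all_right_invariant_bi_invariant_iff
  proof (intro iffI)
    assume conj_self_or_inv
    then show "comm_group G \<or> (\<exists>H :: 'a monoid. elementary_abelian_2_group H \<and> G \<cong> Q8 \<times>\<times> H)"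
      using noncomm_conj_self_or_inv_imp_Q8_factor by blast
  next
    assume "comm_group G \<or> (\<exists>H :: 'a monoid. elementary_abelian_2_group H \<and> G \<cong> Q8 \<times>\<times> H)"
    then show conj_self_or_inv
    proof (elim disjE exE conjE)
      assume "comm_group G"
      then interpret comm_group G .
      have "g \<otimes>\<^bsub>G\<^esub> x \<otimes>\<^bsub>G\<^esub> inv\<^bsub>G\<^esub> g = x" if "g \<in> carrier G" "x \<in> carrier G" for g x
        using that by (metis inv_solve_right m_closed m_comm)
      then show conj_self_or_inv
        by (simp add: conj_self_or_inv_def)
    next
      fix H :: "'a monoid"
      assume H: "elementary_abelian_2_group H" and iso: "G \<cong> Q8 \<times>\<times> H"
      have "group H"
        using H by (simp add: elementary_abelian_2_group_iff)
      then show conj_self_or_inv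
        using conj_self_or_inv_iso[OF assms DirProd_group[OF group_Q8] iso]
          conj_self_or_inv_Q8_DirProd[OF H] by blast
    qed
  qed
next
  interpret group G by fact
  assume "finite (carrier G) \<and> \<not> comm_group G \<and>
    (\<forall>d. right_invariant_metric G d \<longrightarrow> bi_invariant_metric G d)"
  then have fin: "finite (carrier G)" and nc: "\<not> comm_group G"
    and all: "\<forall>d. right_invariant_metric G d \<longrightarrow> bi_invariant_metric G d"
    by blast+
  have conj_self_or_inv
    using all unfolding all_right_invariant_bi_invariant_iff .
  then obtain H :: "'a monoid" where H: "elementary_abelian_2_group H" and iso: "G \<cong> Q8 \<times>\<times> H"
    using noncomm_conj_self_or_inv_imp_Q8_factor nc by blast
  have "finite (carrier H)"
    using finite_factor_of_DirProd[OF iso fin group_Q8] .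
  then obtain k :: nat where k: "product_group {..<k} (\<lambda>_. integer_mod_group 2) \<cong> H"
    using finite_elementary_abelian_2_iso[OF H] by blast
  let ?P = "product_group {..<k} (\<lambda>_. integer_mod_group 2)"
  have "H \<cong> ?P"
    using group.iso_sym[OF _ k] by simp
  then have iso_P: "G \<cong> Q8 \<times>\<times> ?P"
    by (rule iso_trans[OF iso group.DirProd_iso_trans[OF group_Q8 iso_refl]])
  have "card (carrier ?P) = 2 ^ k" "finite (carrier ?P)"
    by (simp_all add: card_PiE carrier_integer_mod_group finite_PiE)
  then have "num_right_invariant G = Bell (5 * 2 ^ k - 1)"
    using num_right_invariant_Q8_DirProd[OF assms iso_P elementary_abelian_2_group_product] by simp
  then show "\<exists>k :: nat. G \<cong> Q8 \<times>\<times> product_group {..<k} (\<lambda>_. integer_mod_group 2) \<and>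
      num_right_invariant G = Bell (5 * 2 ^ k - 1) \<and> num_bi_invariant G = Bell (5 * 2 ^ k - 1)"
    using iso_P num_bi_invariant_eq_num_right_invariant[OF all] by (intro exI[of _ k]) simp
qed

end
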